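(* Assume that $\psi$ satisfies (A1)--(A3) below. Then there exists a constant $C=C_{\Lambda,N}>0$, depending only on $\Lambda$ and $N$, such that for every $f\in\mathcal A(\mathbb R^N)$, $$\int_{\mathbb R^N}\Big(\tfrac12|v-u_f|^2\,\big|f-M_\psi[f]\big|+\big|\Psi(f)-\Psi(M_\psi[f])\big|\Big)dv\le C\Big(\sqrt{\Phi_\psi(\rho_f)}\,\sqrt{R\mathcal F(f)}+R\mathcal F(f)\Big),$$ where $$R\mathcal F(f)=\int_{\mathbb R^N}\Big(\tfrac12|v|^2f+\Psi(f)\Big)dv-\int_{\mathbb R^N}\Big(\tfrac12|v|^2M_\psi[f]+\Psi(M_\psi[f])\Big)dv .$$
   Context: $N\ge1$ is an integer; $(a)_+=\max\{a,0\}$. $\psi:[0,\infty)\to[0,\infty)$ is continuous, of class $\mathcal C^3$ on $(0,\infty)$, and onto, so that under (A1)--(A2) the inverse $\psi^{-1}:[0,\infty)\to[0,\infty)$ is defined. $\Psi(s)=\int_0^s\psi(w)\,dw$. Assumptions: (A1) $\psi'(s)>0$ for all $s>0$. (A2) $\psi(0)=0$. (A3) There is $\Lambda\ge1$ such that for all $0\le s_1<s_2<2s_1$: $\frac1\Lambda(\psi^{-1})'(s_1)\le(\psi^{-1})'(s_2)\le\Lambda(\psi^{-1})'(s_1)$. $h_\psi:[0,\infty)\to[0,\infty)$ is the strictly increasing function with $h_\psi(0)=0$ determined by $\int_{\mathbb R^N}\psi^{-1}\big((h_\psi(\rho)-\tfrac12|v|^2)_+\big)dv=\rho$ for all $\rho\ge0$,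 and $\Phi_\psi(\rho)=\int_0^\rho h_\psi(s)\,ds$. Admissible class: $\mathcal A(\mathbb R^N)=\{f\in L^1(\mathbb R^N): f\ge0,\ |v|^2f+\Psi(f)\in L^1(\mathbb R^N)\}$. For $f\in\mathcal A(\mathbb R^N)$: $\rho_f=\int f\,dv$, $u_f=\frac1{\rho_f}\int vf\,dv$ if $\rho_f>0$ and $u_f=0$ if $\rho_f=0$. The local Maxwellian of $f$ is $$M_\psi[f](v)=\psi^{-1}\Big(\big(h_\psi(\rho_f)-\tfrac12|v-u_f|^2\big)_+\Big).$$ *)

theory Defs
  imports "HOL-Analysis.Analysis"
begin

text \<open>
  Functions on \<open>[0,\<infinity>)\<close> are represented by functions \<open>real \<Rightarrow> real\<close> of which only the values on
  \<open>{0..}\<close> matter. \<open>\<real>\<^sup>N\<close> is \<open>real ^ 'n\<close> with \<open>N = CARD('n) \<ge> 1\<close>, and \<open>L\<^sup>1\<close> refers to Lebesgue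
  measure.
\<close>

definition C3_on :: "(real \<Rightarrow> real) \<Rightarrow> real set \<Rightarrow> bool" \<comment> \<open>intended for open sets\<close>
  where "C3_on g S \<longleftrightarrow>
    (\<forall>k<3. \<forall>s\<in>S. ((deriv ^^ k) g) differentiable (at s)) \<and> continuous_on S ((deriv ^^ 3) g)"

definition psi_basic :: "(real \<Rightarrow> real) \<Rightarrow> bool"
  where "psi_basic \<psi> \<longleftrightarrow> continuous_on {0..} \<psi> \<and> C3_on \<psi> {0<..} \<and> \<psi> ` {0..} = {0..}"

definition psi_inv :: "(real \<Rightarrow> real) \<Rightarrow> real \<Rightarrow> real"
  where "psi_inv \<psi> = inv_into {0..} \<psi>"

definition A1 :: "(real \<Rightarrow> real) \<Rightarrow> bool"
  where "A1 \<psi> \<longleftrightarrow> (\<forall>s>0. deriv \<psi> s > 0)"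

definition A2 :: "(real \<Rightarrow> real) \<Rightarrow> bool"
  where "A2 \<psi> \<longleftrightarrow> \<psi> 0 = 0"

text \<open>
  The conditions on \<open>s\<^sub>1\<close> and \<open>s\<^sub>2\<close> force \<open>s\<^sub>1 > 0\<close>, so \<open>deriv\<close> is only taken at interior points.
\<close>

definition A3 :: "real \<Rightarrow> (real \<Rightarrow> real) \<Rightarrow> bool"
  where "A3 \<Lambda> \<psi> \<longleftrightarrow>
    (\<forall>s\<^sub>1 s\<^sub>2. 0 \<le> s\<^sub>1 \<and> s\<^sub>1 < s\<^sub>2 \<and> s\<^sub>2 < 2 * s\<^sub>1 \<longrightarrow>
      1 / \<Lambda> * deriv (psi_inv \<psi>) s\<^sub>1 \<le> deriv (psi_inv \<psi>) s\<^sub>2 \<and>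
      deriv (psi_inv \<psi>) s\<^sub>2 \<le> \<Lambda> * deriv (psi_inv \<psi>) s\<^sub>1)"

definition Psi :: "(real \<Rightarrow> real) \<Rightarrow> real \<Rightarrow> real"
  where "Psi \<psi> s = integral {0..s} \<psi>"

text \<open>
  For \<open>\<psi>\<close> as above the integral defining \<open>h_psi\<close> is \<open>0\<close> at \<open>t = 0\<close> and is a continuous, strictly
  increasing function of \<open>t \<ge> 0\<close>, unbounded above. So for every \<open>\<rho> \<ge> 0\<close> exactly one \<open>t \<ge> 0\<close>
  satisfies the equation, and the resulting function is strictly increasing and vanishes at \<open>0\<close>.
  The type argument carries the dimension.
\<close>

definition h_psi :: "'n::finite itself \<Rightarrow> (real \<Rightarrow> real) \<Rightarrow> real \<Rightarrow> real"
  where "h_psi _ \<psi> \<rho> =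
    (THE t. 0 \<le> t \<and>
      has_bochner_integral lebesgue
        (\<lambda>v :: real ^ 'n. psi_inv \<psi> (max (t - 1/2 * (norm v)\<^sup>2) 0)) \<rho>)"

definition Phi_psi :: "'n::finite itself \<Rightarrow> (real \<Rightarrow> real) \<Rightarrow> real \<Rightarrow> real"
  where "Phi_psi n \<psi> \<rho> = integral {0..\<rho>} (h_psi n \<psi>)"

definition admissible :: "(real \<Rightarrow> real) \<Rightarrow> (real ^ 'n::finite \<Rightarrow> real) set"
  where "admissible \<psi> =
    {f. integrable lebesgue f \<and> (AE v in lebesgue. 0 \<le> f v) \<and>
        integrable lebesgue (\<lambda>v. (norm v)\<^sup>2 * f v + Psi \<psi> (f v))}"

definition rho :: "(real ^ 'n::finite \<Rightarrow> real) \<Rightarrow> real"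
  where "rho f = (LINT v|lebesgue. f v)"

definition bulk_velocity :: "(real ^ 'n::finite \<Rightarrow> real) \<Rightarrow> real ^ 'n"
  where "bulk_velocity f =
    (if rho f > 0 then (1 / rho f) *\<^sub>R (LINT v|lebesgue. f v *\<^sub>R v) else 0)"

definition maxwellian :: "(real \<Rightarrow> real) \<Rightarrow> (real ^ 'n::finite \<Rightarrow> real) \<Rightarrow> real ^ 'n \<Rightarrow> real"
  where "maxwellian \<psi> f v =
    psi_inv \<psi> (max (h_psi TYPE('n) \<psi> (rho f) - 1/2 * (norm (v - bulk_velocity f))\<^sup>2) 0)"

definition free_energy :: "(real \<Rightarrow> real) \<Rightarrow> (real ^ 'n::finite \<Rightarrow> real) \<Rightarrow> real"
  where "free_energy \<psi> f = (LINT v|lebesgue. 1/2 * (norm v)\<^sup>2 * f v + Psi \<psi> (f v))"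

definition rel_free_energy :: "(real \<Rightarrow> real) \<Rightarrow> (real ^ 'n::finite \<Rightarrow> real) \<Rightarrow> real"
  where "rel_free_energy \<psi> f = free_energy \<psi> f - free_energy \<psi> (maxwellian \<psi> f)"

end

theory Submission
  imports Defs
begin

text \<open>
  Write \<open>h = h\<^sub>\<psi>(\<rho>\<^sub>f)\<close>, \<open>x = h - |v - u\<^sub>f|\<^sup>2/2\<close>, so that the Maxwellian is \<open>M = \<psi>\<^sup>-\<^sup>1(x\<^sub>+)\<close>. As \<open>f\<close> and \<open>M\<close>
  share mass and momentum, the relative free energy \<open>R\<close> is the integral of
  \<open>E = \<Psi>(f) - \<Psi>(M) - x (f - M) \<ge> 0\<close>, and the integrand of the theorem is at most
  \<open>h |f - M| + E\<close>. Convexity of \<open>\<Psi>\<close> at the midpoint \<open>m = (f + M)/2\<close> gives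
  \<open>E \<ge> |f - M| |\<psi>(m) - x| / 2\<close>; hence either \<open>|\<psi>(m) - x| \<ge> \<delta>\<close> and \<open>|f - M| \<le> 2 E/\<delta>\<close>, or
  \<open>|f - M| = 2 |m - M| \<le> 2 (\<psi>\<^sup>-\<^sup>1((x + \<delta>)\<^sub>+) - \<psi>\<^sup>-\<^sup>1((x - \<delta>)\<^sub>+))\<close>. Let \<open>mass t\<close> be the mass of the
  Maxwellian profile with \<open>h = t\<close>. Integrating the alternative gives
  \<open>h \<integral>|f - M| \<le> (2h/\<delta>) R + 2h (mass (h + \<delta>) - mass (h - \<delta>))\<close>. Scaling and the doubling
  condition bound the increment of \<open>mass\<close> by \<open>C (\<delta>/h) \<rho>\<^sub>f\<close>, and \<open>h \<rho>\<^sub>f \<le> 8 \<Phi>\<^sub>\<psi>(\<rho>\<^sub>f)\<close>. With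
  \<open>\<delta> = \<epsilon>h/4\<close> the bound is \<open>C (\<epsilon> \<Phi>\<^sub>\<psi>(\<rho>\<^sub>f) + R/\<epsilon>)\<close> for every \<open>\<epsilon> \<in> (0,1]\<close>, and optimising \<open>\<epsilon>\<close> concludes.
\<close>

section \<open>Changes of variables and elementary inequalities\<close>

lemma integral_lebesgue_affine:
  fixes F :: "'a::euclidean_space \<Rightarrow> real"
  assumes [measurable]: "F \<in> borel_measurable borel" and "c \<noteq> 0"
  shows "(LINT v|lebesgue. F v) = \<bar>c\<bar> ^ DIM('a) * (LINT v|lebesgue. F (t + c *\<^sub>R v))"
proof -
  have "(LINT v|lebesgue. F v) = (LINT v|lborel. F v)"
    by (simp add: integral_completion)
  also have "\<dots> = (LINT v|density (distr lborel borel (\<lambda>x. t + c *\<^sub>R x)) (\<lambda>_. \<bar>c\<bar> ^ DIM('a)). F v)"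
    using lborel_affine[OF assms(2), of t] by simp
  also have "\<dots> = \<bar>c\<bar> ^ DIM('a) * (LINT v|lborel. F (t + c *\<^sub>R v))"
    by (subst integral_density) (auto simp: integral_distr)
  finally show ?thesis by (simp add: integral_completion)
qed

text \<open>Maxwellian profiles, their second moments and their images under \<Psi> are all of this
  kind.\<close>

lemma integrable_lebesgue_bounded_support:
  fixes F :: "'a::euclidean_space \<Rightarrow> real"
  assumes "F \<in> borel_measurable borel" "\<And>v. norm v \<le> R \<Longrightarrow> \<bar>F v\<bar> \<le> B"
    "\<And>v. R < norm v \<Longrightarrow> F v = 0"
  shows "integrable lebesgue F"
proof -
  have "integrable lborel F"
    by (rule integrableI_bounded_set[where A = "cball 0 R" and B = B])
      (use assms emeasure_lborel_cball_finite[of "0 :: 'a" R] in \<open>auto simp: less_top\<close>)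
  then show ?thesis using assms(1) by (simp add: integrable_completion)
qed

text \<open>A convex function of \<open>q\<close> lies below its chord over
  \<open>[0, 1]\<close>.\<close>

lemma one_plus_power_le:
  fixes q :: real
  assumes "0 \<le> q" "q \<le> 1" shows "(1 + q) ^ n \<le> 1 + (2 ^ n - 1) * q"
proof (induction n)
  case (Suc n)
  have "(1 + q) ^ Suc n \<le> (1 + (2 ^ n - 1) * q) * (1 + q)"
    using Suc assms by (simp add: mult.commute mult_right_mono)
  also have "\<dots> = 1 + 2 ^ n * q + (2 ^ n - 1) * (q * q)" by (simp add: algebra_simps)
  also have "(2 ^ n - 1) * (q * q) \<le> (2 ^ n - 1) * (q * 1)"
    using assms by (intro mult_left_mono) auto
  finally show ?case by (simp add: algebra_simps)
qed simp

text \<open>The two terms balance at \<open>\<epsilon> = sqrt (R / \<Phi>)\<close>. This is positive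
  and at most 1 only in the last case; the first two cases treat the rest.\<close>

lemma sqrt_interpolation:
  fixes X \<Phi> R c :: real
  assumes "0 \<le> \<Phi>" "0 \<le> R" "0 \<le> c"
    and le: "\<And>\<epsilon>. 0 < \<epsilon> \<Longrightarrow> \<epsilon> \<le> 1 \<Longrightarrow> X \<le> c * (\<epsilon> * \<Phi> + R / \<epsilon>)"
  shows "X \<le> 2 * c * (sqrt \<Phi> * sqrt R + R)"
proof -
  consider "R = 0" | "\<Phi> \<le> R" | "0 < R" "R < \<Phi>" using assms by linarith
  then show ?thesis
  proof cases
    case 1
    have "X \<le> 0"
    proof (rule ccontr)
      assume X: "\<not> X \<le> 0"
      have "X \<le> c * \<Phi>" using le[of 1] 1 by simp
      with X have "0 < c * \<Phi>" by linarith
      then have pos: "0 < c * \<Phi>" "c \<noteq> 0" "\<Phi> \<noteq> 0" by auto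
      \<comment> \<open>With \<open>R = 0\<close> the bound is
        \<open>c * \<epsilon> * \<Phi>\<close>. This \<open>\<epsilon>\<close>, at most 1/2 because
        \<open>X \<le> c * \<Phi>\<close>, turns it into \<open>X / 2\<close>.\<close>
      have "X \<le> c * (X / (2 * (c * \<Phi>)) * \<Phi>)"
        using le[of "X / (2 * (c * \<Phi>))"] 1 X pos \<open>X \<le> c * \<Phi>\<close> by (simp add: pos_divide_le_eq)
      also have "\<dots> = X / 2" using pos by (auto simp: field_simps)
      finally show False using X by simp
    qed
    then show ?thesis using 1 by simp
  next
    case 2
    have "0 \<le> sqrt \<Phi> * sqrt R" using assms by simp
    then have "\<Phi> + R \<le> 2 * (sqrt \<Phi> * sqrt R + R)" using 2 by argo
    have "X \<le> c * (\<Phi> + R)" using le[of 1] by simp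
    also have "\<dots> \<le> c * (2 * (sqrt \<Phi> * sqrt R + R))" using \<open>\<Phi> + R \<le> _\<close> assms
      by (intro mult_left_mono) auto
    finally show ?thesis by (simp add: algebra_simps)
  next
    case 3
    define a b where "a = sqrt \<Phi>" and "b = sqrt R"
    have ab: "0 < b" "b \<le> a" "\<Phi> = a * a" "R = b * b" using 3 by (auto simp: a_def b_def)
    then have "X \<le> c * (2 * (a * b))" using le[of "b / a"] by (simp add: mult.commute)
    also have "\<dots> \<le> c * (2 * (sqrt \<Phi> * sqrt R + R))"
      using assms unfolding a_def b_def by (intro mult_left_mono) auto
    finally show ?thesis by (simp add: algebra_simps)
  qed
qed

lemma integrable_first_moment:
  fixes f :: "'a::euclidean_space \<Rightarrow> real"
  assumes f: "integrable lebesgue f" and m: "integrable lebesgue (\<lambda>v. (norm v)\<^sup>2 * f v)"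
  shows "integrable lebesgue (\<lambda>v. f v *\<^sub>R v)"
proof (rule Bochner_Integration.integrable_bound)
  show "integrable lebesgue (\<lambda>v. \<bar>f v\<bar> + \<bar>(norm v)\<^sup>2 * f v\<bar>)" using f m by auto
  have [measurable]: "f \<in> borel_measurable lebesgue" using f by auto
  have [measurable]: "(\<lambda>v :: 'a. v) \<in> borel_measurable lebesgue"
    by (rule measurable_completion) simp
  show "(\<lambda>v. f v *\<^sub>R v) \<in> borel_measurable lebesgue" by measurable
  have "norm v \<le> 1 + (norm v)\<^sup>2" for v :: 'a
    using zero_le_power2[of "norm v - 1/2"] by (simp add: power2_eq_square algebra_simps)
  then have "\<bar>f v\<bar> * norm v \<le> \<bar>f v\<bar> * (1 + (norm v)\<^sup>2)" for v
    by (rule mult_left_mono) simp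
  then show "AE v in lebesgue. norm (f v *\<^sub>R v) \<le> norm (\<bar>f v\<bar> + \<bar>(norm v)\<^sup>2 * f v\<bar>)"
    by (intro AE_I2) (simp add: abs_mult algebra_simps)
qed

section \<open>Estimates in one dimension\<close>

text \<open>Keeping \<Lambda> as a parameter lets the constants below be read off as expressions in
  \<Lambda> and the dimension.\<close>

locale doubling_psi =
  fixes \<psi> :: "real \<Rightarrow> real" and \<Lambda> :: real
  assumes basic: "psi_basic \<psi>" and a1: "A1 \<psi>" and a2: "A2 \<psi>" and a3: "A3 \<Lambda> \<psi>"
    and Lambda_ge_1: "1 \<le> \<Lambda>"
begin

abbreviation "g \<equiv> psi_inv \<psi>"
abbreviation "g' \<equiv> deriv (psi_inv \<psi>)"

text \<open>\<open>g\<close> is unspecified on negative arguments; extension by 0 makes the inverse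
  a monotone, hence Borel, function on the whole line.\<close>

definition gp :: "real \<Rightarrow> real"
  where "gp s = g (max s 0)"

section \<open>Monotonicity and inversion of \<psi>\<close>

lemma psi_0 [simp]: "\<psi> 0 = 0"
  using a2 by (simp add: A2_def)

lemma continuous_psi: "continuous_on {0..} \<psi>"
  using basic by (simp add: psi_basic_def)

lemma psi_has_deriv: "0 < s \<Longrightarrow> (\<psi> has_real_derivative deriv \<psi> s) (at s)"
  using basic by (force simp: psi_basic_def C3_on_def DERIV_deriv_iff_real_differentiable
      dest!: spec[of _ 0])

lemma deriv_psi_pos: "0 < s \<Longrightarrow> 0 < deriv \<psi> s"
  using a1 by (simp add: A1_def)

lemma psi_strict_mono: "0 \<le> a \<Longrightarrow> a < b \<Longrightarrow> \<psi> a < \<psi> b"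
  by (rule DERIV_pos_imp_increasing_open)
    (auto intro!: exI psi_has_deriv deriv_psi_pos continuous_on_subset[OF continuous_psi])

lemma psi_less_iff: "0 \<le> a \<Longrightarrow> 0 \<le> b \<Longrightarrow> \<psi> a < \<psi> b \<longleftrightarrow> a < b"
  by (metis linorder_neqE_linordered_idom less_asym psi_strict_mono)

lemma psi_le_iff: "0 \<le> a \<Longrightarrow> 0 \<le> b \<Longrightarrow> \<psi> a \<le> \<psi> b \<longleftrightarrow> a \<le> b"
  by (meson not_le psi_less_iff)

lemma inj_psi: "inj_on \<psi> {0..}"
  by (rule linorder_inj_onI) (auto dest: psi_strict_mono)

lemma psi_nonneg: "0 \<le> s \<Longrightarrow> 0 \<le> \<psi> s"
  using psi_le_iff[of 0 s] by simp

lemma psi_image: "\<psi> ` {0..} = {0..}"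
  using basic by (simp add: psi_basic_def)

lemma g_psi [simp]: "0 \<le> s \<Longrightarrow> g (\<psi> s) = s"
  by (simp add: psi_inv_def inj_psi)

lemma psi_g [simp]: "0 \<le> s \<Longrightarrow> \<psi> (g s) = s"
  by (simp add: psi_inv_def psi_image f_inv_into_f)

lemma g_nonneg: "0 \<le> s \<Longrightarrow> 0 \<le> g s"
  using inv_into_into[of s \<psi> "{0..}"] by (simp add: psi_inv_def psi_image)

lemma g_0 [simp]: "g 0 = 0"
  using g_psi[of 0] by (simp del: g_psi)

lemma g_less_iff: "0 \<le> a \<Longrightarrow> 0 \<le> b \<Longrightarrow> g a < g b \<longleftrightarrow> a < b"
  using psi_less_iff[of "g a" "g b"] by (simp add: g_nonneg)

lemma g_le_iff: "0 \<le> a \<Longrightarrow> 0 \<le> b \<Longrightarrow> g a \<le> g b \<longleftrightarrow> a \<le> b"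
  using psi_le_iff[of "g a" "g b"] by (simp add: g_nonneg)

lemma g_pos: "0 < s \<Longrightarrow> 0 < g s"
  using g_less_iff[of 0 s] by simp

lemma gp_nonneg [simp]: "0 \<le> gp s"
  by (simp add: gp_def g_nonneg)

lemma gp_eq_0: "s \<le> 0 \<Longrightarrow> gp s = 0"
  by (simp add: gp_def max_def)

lemma gp_eq: "0 \<le> s \<Longrightarrow> gp s = g s"
  by (simp add: gp_def max_def)

lemma mono_gp: "mono gp"
  by (rule monoI) (simp add: gp_def g_le_iff)

lemma gp_mono: "a \<le> b \<Longrightarrow> gp a \<le> gp b"
  using mono_gp by (rule monoD)

lemma gp_measurable [measurable]: "gp \<in> borel_measurable borel"
  by (rule borel_measurable_mono[OF mono_gp])

lemma psi_gp: "\<psi> (gp s) = max s 0"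
  by (simp add: gp_def)

section \<open>Growth of the inverse under the doubling condition\<close>

lemma g_has_deriv:
  assumes "0 < s" shows "(g has_real_derivative g' s) (at s)"
proof -
  have pos: "0 < g s" using assms by (rule g_pos)
  have "(g has_derivative (\<lambda>x. inverse (deriv \<psi> (g s)) * x)) (at s)"
  proof (rule has_derivative_inverse_strong_x[where S = "{0<..}" and f = \<psi>])
    show "(\<psi> has_derivative (\<lambda>x. deriv \<psi> (g s) * x)) (at (g s))"
      using psi_has_deriv[OF pos] by (simp add: has_field_derivative_def)
    show "(\<lambda>x. deriv \<psi> (g s) * x) \<circ> (\<lambda>x. inverse (deriv \<psi> (g s)) * x) = id"
      using deriv_psi_pos[OF pos] by (auto simp: fun_eq_iff)
  qed (use pos assms in \<open>auto intro: continuous_on_subset[OF continuous_psi]\<close>)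
  then have "(g has_real_derivative inverse (deriv \<psi> (g s))) (at s)"
    by (simp add: has_field_derivative_def)
  \<comment> \<open>The explicit value is traded for \<open>deriv g\<close>, the quantity that
    \<open>A3\<close> controls.\<close>
  then show ?thesis by (simp add: DERIV_imp_deriv)
qed

lemma g_MVT:
  assumes "0 < a" "a < b"
  obtains z where "a < z" "z < b" "g b - g a = (b - a) * g' z"
  using MVT2[of a b g g'] assms g_has_deriv by auto

lemma g_deriv_bounds:
  assumes "0 < s" "s < t" "t < 2 * s"
  shows "g' s \<le> \<Lambda> * g' t" "g' t \<le> \<Lambda> * g' s"
proof -
  have "1 / \<Lambda> * g' s \<le> g' t" "g' t \<le> \<Lambda> * g' s"
    using a3 assms by (auto simp: A3_def)
  then show "g' s \<le> \<Lambda> * g' t" "g' t \<le> \<Lambda> * g' s"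
    using Lambda_ge_1 by (auto simp: field_simps)
qed

text \<open>The mean value theorem on \<open>[s/2, s]\<close> gives a point \<open>z\<close> with
  \<open>s < 2 * z\<close>, so doubling compares the derivatives at \<open>z\<close> and
  \<open>s\<close>; the increment of \<open>g\<close> is at most \<open>g s\<close>.\<close>

lemma g_deriv_le:
  assumes "0 < s" shows "s * g' s \<le> 2 * \<Lambda> * g s"
proof -
  obtain z where z: "s/2 < z" "z < s" "g s - g (s/2) = (s - s/2) * g' z"
    using g_MVT[of "s/2" s] assms by auto
  have "g' s \<le> \<Lambda> * g' z" using g_deriv_bounds(2)[of z s] z assms by auto
  then have "s * g' s \<le> s * (\<Lambda> * g' z)" using assms by (intro mult_left_mono) auto
  also have "\<dots> = 2 * \<Lambda> * (g s - g (s/2))" using z(3) by (simp add: field_simps)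
  also have "\<dots> \<le> 2 * \<Lambda> * g s"
    using Lambda_ge_1 assms g_nonneg[of "s/2"] by (intro mult_left_mono) auto
  finally show ?thesis .
qed

text \<open>One factor \<Lambda> moves the derivative from the intermediate point to
  \<open>b\<close>, the other comes from \<open>g_deriv_le\<close> at \<open>b\<close>.\<close>

lemma g_increment_le:
  assumes "0 < b" "b \<le> a" "a < 2 * b"
  shows "g a \<le> (1 + 2 * \<Lambda>\<^sup>2 * (a/b - 1)) * g b"
proof (cases "a = b")
  case False
  then obtain z where z: "b < z" "z < a" "g a - g b = (a - b) * g' z"
    using g_MVT[of b a] assms by auto
  have "g' z \<le> \<Lambda> * g' b" using g_deriv_bounds(2)[of b z] z assms by auto
  then have "b * g' z \<le> \<Lambda> * (b * g' b)" using assms by (simp add: mult.left_commute)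
  also have "\<dots> \<le> \<Lambda> * (2 * \<Lambda> * g b)"
    using Lambda_ge_1 assms by (intro mult_left_mono g_deriv_le) auto
  finally have "g' z \<le> 2 * \<Lambda>\<^sup>2 * g b / b" using assms by (simp add: field_simps power2_eq_square)
  then have "(a - b) * g' z \<le> (a - b) * (2 * \<Lambda>\<^sup>2 * g b / b)"
    using assms by (intro mult_left_mono) auto
  also have "\<dots> = 2 * \<Lambda>\<^sup>2 * (a/b - 1) * g b" using assms by (simp add: field_simps)
  finally show ?thesis using z(3) by (simp add: algebra_simps)
qed auto

lemma gp_increment_le:
  assumes "0 < b" "b \<le> a" "a < 2 * b"
  shows "gp (a * s) \<le> (1 + 2 * \<Lambda>\<^sup>2 * (a/b - 1)) * gp (b * s)"
proof (cases "s \<le> 0")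
  case True
  then show ?thesis using assms by (simp add: gp_eq_0 mult_nonneg_nonpos)
next
  case False
  then show ?thesis using g_increment_le[of "b * s" "a * s"] assms by (simp add: gp_eq)
qed

section \<open>Convexity of \<Psi> and its Bregman divergence\<close>

lemma psi_integrable: "0 \<le> a \<Longrightarrow> \<psi> integrable_on {a..b}"
  by (rule integrable_continuous_real) (auto intro: continuous_on_subset[OF continuous_psi])

lemma Psi_diff: "0 \<le> a \<Longrightarrow> a \<le> b \<Longrightarrow> Psi \<psi> b - Psi \<psi> a = integral {a..b} \<psi>"
  using Henstock_Kurzweil_Integration.integral_combine[of 0 a b \<psi>] psi_integrable[of 0 b] by (simp add: Psi_def)

lemma Psi_tangent:
  assumes "0 \<le> a" "0 \<le> b" shows "\<psi> a * (b - a) \<le> Psi \<psi> b - Psi \<psi> a"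
proof (cases "a \<le> b")
  case True
  have "integral {a..b} (\<lambda>_. \<psi> a) \<le> integral {a..b} \<psi>"
    using assms by (intro integral_le psi_integrable) (auto simp: psi_le_iff)
  then show ?thesis using True assms by (simp add: Psi_diff mult.commute)
next
  case False
  have "integral {b..a} \<psi> \<le> integral {b..a} (\<lambda>_. \<psi> a)"
    using assms by (intro integral_le psi_integrable) (auto simp: psi_le_iff)
  then show ?thesis using False assms Psi_diff[of b a] by (simp add: algebra_simps)
qed

text \<open>For negative \<open>s\<close> the interval of integration is empty. This makes
  \<open>Psi\<close> monotone, hence Borel, on the whole line.\<close>

lemma Psi_eq_0: "s \<le> 0 \<Longrightarrow> Psi \<psi> s = 0"
  unfolding Psi_def by (cases "s = 0") auto

lemma Psi_nonneg: "0 \<le> Psi \<psi> s"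
  using Psi_tangent[of 0 s] Psi_eq_0[of s] Psi_eq_0[of 0] by (cases "0 \<le> s") auto

lemma mono_Psi: "mono (Psi \<psi>)"
proof (rule monoI)
  fix a b :: real assume ab: "a \<le> b"
  show "Psi \<psi> a \<le> Psi \<psi> b"
  proof (cases "0 \<le> a")
    case True
    then show ?thesis using Psi_tangent[of a b] ab psi_nonneg[of a]
      by (smt (verit) mult_nonneg_nonneg)
  qed (use Psi_nonneg Psi_eq_0 in auto)
qed

lemma Psi_measurable [measurable]: "Psi \<psi> \<in> borel_measurable borel"
  by (rule borel_measurable_mono[OF mono_Psi])

text \<open>The Bregman divergence of \<open>\<Psi>\<close> at \<open>gp x\<close>, but with slope \<open>x\<close> even when \<open>x < 0 = \<psi> (gp x)\<close>.\<close>

definition bregman :: "real \<Rightarrow> real \<Rightarrow> real"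
  where "bregman x r = Psi \<psi> r - Psi \<psi> (gp x) - x * (r - gp x)"

text \<open>Tangent inequalities at \<open>gp x\<close> and at the midpoint \<open>m\<close> are
  added. The slope \<open>max x 0\<close> at \<open>gp x\<close> may be lowered to \<open>x\<close>,
  since \<open>m - gp x\<close> is nonnegative when \<open>x \<le> 0\<close>.\<close>

lemma bregman_ge:
  assumes "0 \<le> r"
  shows "\<bar>r - gp x\<bar> * \<bar>\<psi> ((r + gp x) / 2) - x\<bar> / 2 \<le> bregman x r"
proof -
  define m where "m = (r + gp x) / 2"
  have m: "0 \<le> m" using assms by (simp add: m_def)
  have 1: "\<psi> m * (r - m) \<le> Psi \<psi> r - Psi \<psi> m" by (rule Psi_tangent) (use m assms in auto)
  have "max x 0 * (m - gp x) \<le> Psi \<psi> m - Psi \<psi> (gp x)"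
    using Psi_tangent[of "gp x" m] m by (simp add: psi_gp)
  moreover have "x * (m - gp x) \<le> max x 0 * (m - gp x)"
    using m by (cases "x \<le> 0") (auto simp: gp_eq_0 mult_nonpos_nonneg)
  ultimately have "(\<psi> m - x) * (r - m) \<le> bregman x r"
    using 1 by (simp add: bregman_def algebra_simps)
  \<comment> \<open>The two factors have the same sign, so absolute values can be inserted in the
    product.\<close>
  moreover have "0 \<le> (\<psi> m - x) * (r - gp x)"
  proof (cases "gp x \<le> r")
    case True
    then have "max x 0 \<le> \<psi> m"
      using psi_le_iff[of "gp x" m] m by (simp add: m_def psi_gp)
    then show ?thesis using True by simp
  next
    case False
    then have "0 < x" using assms gp_eq_0[of x] by force
    moreover have "\<psi> m \<le> max x 0"
      using False psi_le_iff[of m "gp x"] m by (simp add: m_def psi_gp)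
    ultimately show ?thesis using False by (intro mult_nonpos_nonpos) auto
  qed
  ultimately show ?thesis
    by (simp add: abs_mult[symmetric] m_def[symmetric] mult.commute) (simp add: m_def field_simps)
qed

lemma bregman_nonneg: "0 \<le> r \<Longrightarrow> 0 \<le> bregman x r"
  by (rule order_trans[OF _ bregman_ge]) auto

text \<open>Each alternative bounds the left side by one of two nonnegative terms; taking their sum
  avoids splitting the domain when integrating in \<open>v\<close>.\<close>

lemma diff_le_bregman:
  assumes "0 \<le> r" "0 < \<delta>"
  shows "\<bar>r - gp x\<bar> \<le> 2 / \<delta> * bregman x r + 2 * (gp (x + \<delta>) - gp (x - \<delta>))"
proof -
  define m where "m = (r + gp x) / 2"
  have m: "0 \<le> m" using assms by (simp add: m_def)
  show ?thesis
  proof (cases "\<delta> \<le> \<bar>\<psi> m - x\<bar>")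
    case True
    then have "\<bar>r - gp x\<bar> * \<delta> / 2 \<le> bregman x r"
      using bregman_ge[OF assms(1), of x] mult_left_mono[OF True, of "\<bar>r - gp x\<bar>"]
      by (simp add: m_def)
    then have "\<bar>r - gp x\<bar> \<le> 2 / \<delta> * bregman x r" using assms by (simp add: field_simps)
    then show ?thesis using gp_mono[of "x - \<delta>" "x + \<delta>"] assms by simp
  next
    case False
    \<comment> \<open>As \<psi>(m) is within \<delta> of \<open>x\<close>, monotonicity of
      \<open>gp\<close> traps \<open>m\<close> and \<open>gp x\<close> in the same interval.\<close>
    have "m = gp (\<psi> m)" using m by (simp add: gp_eq psi_nonneg)
    then have "gp (x - \<delta>) \<le> m" "m \<le> gp (x + \<delta>)"
      using False gp_mono[of "x - \<delta>" "\<psi> m"] gp_mono[of "\<psi> m" "x + \<delta>"] by auto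
    moreover have "gp (x - \<delta>) \<le> gp x" "gp x \<le> gp (x + \<delta>)"
      using assms by (auto intro: gp_mono)
    ultimately have "\<bar>m - gp x\<bar> \<le> gp (x + \<delta>) - gp (x - \<delta>)" by linarith
    moreover have "r - gp x = 2 * (m - gp x)" by (simp add: m_def)
    ultimately have "\<bar>r - gp x\<bar> \<le> 2 * (gp (x + \<delta>) - gp (x - \<delta>))"
      by (simp only: abs_mult) simp
    moreover have "0 \<le> 2 / \<delta> * bregman x r" using assms bregman_nonneg by simp
    ultimately show ?thesis by (rule add_increasing[rotated])
  qed
qed

text \<open>Here \<open>k\<close> stands for the kinetic term. If \<open>k < h\<close>, the \<Psi>
  difference costs the divergence plus \<open>h - k\<close> times the distance, and
  \<open>k + (h - k) = h\<close>. If \<open>h \<le> k\<close>, then \<open>gp (h - k)\<close> is 0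
  and both sides agree.\<close>

lemma energy_density_le:
  assumes "0 \<le> r" "0 \<le> k" "0 \<le> h"
  shows "k * \<bar>r - gp (h - k)\<bar> + \<bar>Psi \<psi> r - Psi \<psi> (gp (h - k))\<bar>
    \<le> h * \<bar>r - gp (h - k)\<bar> + bregman (h - k) r"
proof (cases "h - k \<le> 0")
  case True
  then show ?thesis using assms Psi_nonneg[of r] Psi_eq_0[of 0]
    by (simp add: gp_eq_0 bregman_def algebra_simps)
next
  case False
  have "\<bar>Psi \<psi> r - Psi \<psi> (gp (h - k))\<bar> \<le> bregman (h - k) r + \<bar>(h - k) * (r - gp (h - k))\<bar>"
    using bregman_nonneg[OF assms(1), of "h - k"] unfolding bregman_def by linarith
  also have "\<bar>(h - k) * (r - gp (h - k))\<bar> = (h - k) * \<bar>r - gp (h - k)\<bar>"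
    using False by (simp add: abs_mult)
  finally show ?thesis by (simp add: algebra_simps)
qed

section \<open>The mass of a Maxwellian profile\<close>

text \<open>This is the integral prescribed by \<open>h_psi\<close>, so that \<open>h_psi\<close>
  becomes its inverse on \<open>{0..}\<close>.\<close>

definition mass :: "'n::finite itself \<Rightarrow> real \<Rightarrow> real"
  where "mass _ t = (LINT v|lebesgue. gp (t - 1/2 * (norm (v :: real ^ 'n))\<^sup>2))"

lemma gp_profile_eq_0:
  assumes "norm u + sqrt (2 * \<bar>t\<bar>) < norm v"
  shows "gp (t - (norm (v - u))\<^sup>2 / 2) = 0"
proof -
  have "sqrt (2 * \<bar>t\<bar>) \<le> norm (v - u)" using assms norm_triangle_ineq2[of v u] by linarith
  then have "2 * \<bar>t\<bar> \<le> (norm (v - u))\<^sup>2" by (metis sqrt_le_D)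
  then show ?thesis by (intro gp_eq_0) auto
qed

lemma gp_profile_le: "gp (t - (norm (v - u))\<^sup>2 / 2) \<le> gp t"
  by (rule gp_mono) simp

text \<open>Outside the ball of this radius \<open>(norm (v - u))\<^sup>2 / 2\<close> exceeds
  \<open>t\<close>; the absolute value covers negative \<open>t\<close>.\<close>

lemma gp_profile_integrable:
  fixes u :: "'a::euclidean_space"
  shows "integrable lebesgue (\<lambda>v. gp (t - 1/2 * (norm (v - u))\<^sup>2))"
  by (rule integrable_lebesgue_bounded_support[where R = "norm u + sqrt (2 * \<bar>t\<bar>)" and B = "gp t"])
    (auto simp: gp_profile_eq_0 gp_profile_le)

lemma gp_profile_moment_integrable:
  fixes u :: "'a::euclidean_space"
  shows "integrable lebesgue (\<lambda>v. (norm v)\<^sup>2 * gp (t - 1/2 * (norm (v - u))\<^sup>2))"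
  by (rule integrable_lebesgue_bounded_support[where R = "norm u + sqrt (2 * \<bar>t\<bar>)"
        and B = "(norm u + sqrt (2 * \<bar>t\<bar>))\<^sup>2 * gp t"])
    (auto simp: gp_profile_eq_0 gp_profile_le abs_mult intro!: mult_mono power_mono)

lemma Psi_gp_profile_integrable:
  fixes u :: "'a::euclidean_space"
  shows "integrable lebesgue (\<lambda>v. Psi \<psi> (gp (t - 1/2 * (norm (v - u))\<^sup>2)))"
  by (rule integrable_lebesgue_bounded_support[where R = "norm u + sqrt (2 * \<bar>t\<bar>)"
        and B = "Psi \<psi> (gp t)"])
    (auto simp: gp_profile_eq_0 Psi_eq_0 Psi_nonneg intro!: monoD[OF mono_Psi] gp_profile_le)

lemma mass_shift:
  "(LINT v|lebesgue. gp (t - 1/2 * (norm (v - u :: real ^ 'n::finite))\<^sup>2)) = mass TYPE('n) t"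
  by (subst integral_lebesgue_affine[where t = u and c = 1]) (simp_all add: mass_def)

lemma mass_mono: "a \<le> b \<Longrightarrow> mass n a \<le> mass n b"
  unfolding mass_def using gp_profile_integrable[where u = 0]
  by (intro integral_mono) (auto intro: gp_mono)

lemma mass_nonneg: "0 \<le> mass n t"
  by (simp add: mass_def)

lemma mass_0 [simp]: "mass n 0 = 0"
  by (simp add: mass_def gp_eq_0)

text \<open>
  Dilating by \<open>sqrt (a/b)\<close> makes the masses at \<open>a\<close> and \<open>b\<close> integrals of \<open>gp (a * s v)\<close> and
  \<open>gp (b * s v)\<close> with the same \<open>s\<close>, so that they can be compared pointwise.
\<close>

lemma mass_scaled:
  fixes a b :: real and n :: "'n::finite itself"
  assumes "0 < a" "0 < b"
  shows "mass n a = sqrt (a/b) ^ CARD('n) *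
    (LINT v|lebesgue. gp (a * (1/b * (b - 1/2 * (norm (v :: real ^ 'n))\<^sup>2))))"
proof -
  have "(sqrt (a/b) * norm v)\<^sup>2 = a/b * (norm v)\<^sup>2" for v :: "real ^ 'n"
    using assms by (simp add: power_mult_distrib)
  then have "a - 1/2 * (norm (sqrt (a/b) *\<^sub>R v))\<^sup>2 = a * (1/b * (b - 1/2 * (norm v)\<^sup>2))"
    for v :: "real ^ 'n"
    using assms by (simp add: field_simps)
  then show ?thesis
    unfolding mass_def
    by (subst integral_lebesgue_affine[where t = 0 and c = "sqrt (a/b)"])
      (use assms in simp_all)
qed

lemma gp_profile_dilated_integrable:
  assumes "0 < a" "0 < b"
  shows "integrable lebesgue (\<lambda>v :: 'a::euclidean_space. gp (a * (1/b * (b - 1/2 * (norm v)\<^sup>2))))"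
proof (rule integrable_lebesgue_bounded_support[where R = "sqrt (2 * b)" and B = "gp a"])
  fix v :: 'a
  have "1/b * (b - 1/2 * (norm v)\<^sup>2) \<le> 1" using assms by (simp add: field_simps)
  then have "a * (1/b * (b - 1/2 * (norm v)\<^sup>2)) \<le> a * 1" using assms by (intro mult_left_mono) auto
  then show "\<bar>gp (a * (1/b * (b - 1/2 * (norm v)\<^sup>2)))\<bar> \<le> gp a"
    by (simp only: abs_of_nonneg gp_nonneg) (simp add: gp_mono)
next
  fix v :: 'a assume "sqrt (2 * b) < norm v"
  then have "2 * b \<le> (norm v)\<^sup>2" by (metis less_imp_le sqrt_le_D)
  then show "gp (a * (1/b * (b - 1/2 * (norm v)\<^sup>2))) = 0"
    using assms by (intro gp_eq_0 mult_nonneg_nonpos) auto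
qed simp

text \<open>The dilation contributes the factor, and \<open>gp\<close> only increases the integrand.
  This growth yields strict monotonicity, surjectivity and \<open>mass_half\<close>.\<close>

lemma mass_scale_ge:
  fixes n :: "'n::finite itself"
  assumes "0 < b" "b \<le> a"
  shows "sqrt (a/b) * mass n b \<le> mass n a"
proof -
  let ?s = "\<lambda>v :: real ^ 'n. 1/b * (b - 1/2 * (norm v)\<^sup>2)"
  have 1: "gp (b * s) \<le> gp (a * s)" for s
    using assms by (cases "s \<le> 0") (auto simp: gp_eq_0 mult_nonneg_nonpos intro: gp_mono)
  have "sqrt (a/b) ^ 1 \<le> sqrt (a/b) ^ CARD('n)"
    using assms by (intro power_increasing) (auto simp: Suc_leI)
  then have "sqrt (a/b) * mass n b \<le> sqrt (a/b) ^ CARD('n) * mass n b"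
    by (intro mult_right_mono) (auto simp: mass_nonneg)
  also have "\<dots> = sqrt (a/b) ^ CARD('n) * (LINT v|lebesgue. gp (b * ?s v))"
    using mass_scaled[of b b n] assms by simp
  also have "\<dots> \<le> sqrt (a/b) ^ CARD('n) * (LINT v|lebesgue. gp (a * ?s v))"
    using assms by (intro mult_left_mono integral_mono gp_profile_dilated_integrable 1) auto
  also have "\<dots> = mass n a"
    using mass_scaled[of a b n] assms by simp
  finally show ?thesis .
qed

text \<open>On the ball of radius \<open>sqrt t\<close> the profile is at least
  \<open>g (t/2)\<close>.\<close>

lemma mass_pos:
  fixes n :: "'n::finite itself"
  assumes "0 < t" shows "0 < mass n t"
proof -
  let ?B = "ball (0 :: real ^ 'n) (sqrt t)"
  have fin: "?B \<in> lmeasurable" by simp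
  have "0 < g (t/2) * measure lebesgue ?B"
    using assms by (simp add: g_pos content_ball_pos)
  also have "\<dots> = (LINT v|lebesgue. g (t/2) * indicator ?B v)"
    using fin by simp
  also have "\<dots> \<le> mass n t"
    unfolding mass_def
  proof (rule integral_mono)
    show "integrable lebesgue (\<lambda>v. g (t/2) * indicator ?B v)"
      using fin by (intro integrable_mult_right) (simp add: fmeasurable_def)
    show "integrable lebesgue (\<lambda>v :: real ^ 'n. gp (t - 1/2 * (norm v)\<^sup>2))"
      using gp_profile_integrable[where u = 0] by simp
    fix v :: "real ^ 'n"
    show "g (t/2) * indicator ?B v \<le> gp (t - 1/2 * (norm v)\<^sup>2)"
    proof (cases "v \<in> ?B")
      case True
      then have "(norm v)\<^sup>2 \<le> (sqrt t)\<^sup>2" by (intro power_mono) auto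
      then show ?thesis using True assms gp_mono[of "t/2" "t - 1/2 * (norm v)\<^sup>2"]
        by (simp add: gp_eq)
    qed simp
  qed
  finally show ?thesis .
qed

lemma mass_strict_mono:
  assumes "0 \<le> b" "b < a" shows "mass n b < mass n a"
proof (cases "b = 0")
  case False
  then have b: "0 < b" using assms by simp
  have "1 * mass n b < sqrt (a/b) * mass n b"
    using assms b mass_pos[of b n] by (intro mult_strict_right_mono) auto
  also have "\<dots> \<le> mass n a" using assms b by (intro mass_scale_ge) auto
  finally show ?thesis by simp
qed (use assms mass_pos in auto)

text \<open>The dilation alone gives a fixed factor below 1, independent of \<Lambda>; it feeds the
  lower bound on \<open>Phi_psi\<close>.\<close>

lemma mass_half:
  assumes "0 \<le> t" shows "mass n (t/2) \<le> 3/4 * mass n t"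
proof (cases "t = 0")
  case False
  have "4/3 \<le> sqrt (2::real)" by (rule real_le_rsqrt) (simp add: power2_eq_square)
  then have "4/3 * mass n (t/2) \<le> sqrt 2 * mass n (t/2)"
    by (rule mult_right_mono) (rule mass_nonneg)
  also have "\<dots> \<le> mass n t" using mass_scale_ge[of "t/2" t n] assms False by simp
  finally show ?thesis by simp
qed simp

text \<open>With \<open>q = a/b - 1\<close>, the Jacobian of the dilation contributes
  \<open>1 + A * q\<close> and the pointwise comparison of \<open>gp\<close> contributes
  \<open>1 + B * q\<close>.\<close>

lemma mass_increment_le:
  fixes n :: "'n::finite itself"
  assumes "0 < b" "b \<le> a" "a < 2 * b"
  shows "mass n a \<le> (1 + 2 ^ CARD('n) * (1 + 2 * \<Lambda>\<^sup>2) * (a/b - 1)) * mass n b"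
proof -
  let ?s = "\<lambda>v :: real ^ 'n. 1/b * (b - 1/2 * (norm v)\<^sup>2)"
  define q A B where "q = a/b - 1" and "A = (2::real) ^ CARD('n) - 1" and "B = 2 * \<Lambda>\<^sup>2"
  have q: "0 \<le> q" "q \<le> 1" "a/b = 1 + q" using assms by (auto simp: q_def field_simps)
  have AB: "0 \<le> A" "0 \<le> B" by (auto simp: A_def B_def)
  have "(1 + A * q) * (1 + B * q) = 1 + (A + B) * q + A * B * (q * q)" by (simp add: algebra_simps)
  \<comment> \<open>As \<open>q \<le> 1\<close>, the quadratic term is absorbed into the linear
    one.\<close>
  also have "A * B * (q * q) \<le> A * B * (q * 1)" using AB q by (intro mult_left_mono) auto
  also have "1 + (A + B) * q + A * B * (q * 1) = 1 + ((1 + A) * (1 + B) - 1) * q"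
    by (simp add: algebra_simps)
  also have "\<dots> \<le> 1 + (1 + A) * (1 + B) * q" using q by (simp add: algebra_simps)
  finally have *: "(1 + A * q) * (1 + B * q) \<le> 1 + (1 + A) * (1 + B) * q" by simp
  have "sqrt (1 + q) \<le> 1 + q" using q by (intro real_le_lsqrt) (auto simp: power2_eq_square algebra_simps)
  then have "sqrt (a/b) ^ CARD('n) \<le> (1 + q) ^ CARD('n)" using q by (simp add: power_mono)
  also have "\<dots> \<le> 1 + A * q" unfolding A_def using q by (intro one_plus_power_le)
  finally have 1: "sqrt (a/b) ^ CARD('n) \<le> 1 + A * q" .
  have "mass n a = sqrt (a/b) ^ CARD('n) * (LINT v|lebesgue. gp (a * ?s v))"
    using mass_scaled[of a b n] assms by simp
  also have "\<dots> \<le> (1 + A * q) * (LINT v|lebesgue. (1 + B * q) * gp (b * ?s v))"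
  proof (intro mult_mono integral_mono gp_profile_dilated_integrable integrable_mult_right)
    show "gp (a * ?s v) \<le> (1 + B * q) * gp (b * ?s v)" for v
      unfolding B_def q_def by (rule gp_increment_le[OF assms])
  qed (use 1 q AB assms in auto)
  also have "\<dots> = (1 + A * q) * (1 + B * q) * mass n b"
    using mass_scaled[of b b n] assms by simp
  also have "\<dots> \<le> (1 + (1 + A) * (1 + B) * q) * mass n b"
    using * by (intro mult_right_mono mass_nonneg)
  finally show ?thesis by (simp add: A_def B_def q_def)
qed

text \<open>The increment bound is a Lipschitz estimate away from 0; \<open>x/2 < b\<close> and
  \<open>b \<le> x\<close> make its constant uniform near \<open>x\<close>.\<close>

lemma isCont_mass:
  fixes n :: "'n::finite itself"
  assumes "0 < x" shows "isCont (mass n) x"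
proof -
  define K where "K = 2 ^ CARD('n) * (1 + 2 * \<Lambda>\<^sup>2)"
  have K: "0 \<le> K" by (simp add: K_def)
  have diff: "mass n a - mass n b \<le> 2 * K * mass n x / x * (a - b)"
    if "x/2 < b" "b \<le> a" "a < 2 * b" "b \<le> x" for a b
  proof -
    have "mass n a - mass n b \<le> K * (a/b - 1) * mass n b"
      using mass_increment_le[of b a n] that assms by (simp add: K_def algebra_simps)
    also have "\<dots> \<le> K * (a/b - 1) * mass n x"
      using that assms K by (intro mult_left_mono mass_mono mult_nonneg_nonneg) auto
    also have "a/b - 1 = (a - b) * (1/b)" using that assms by (simp add: field_simps)
    also have "K * ((a - b) * (1/b)) * mass n x \<le> K * ((a - b) * (2/x)) * mass n x"
      using that assms K by (intro mult_left_mono mult_right_mono mass_nonneg) (auto simp: field_simps)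
    finally show ?thesis by (simp add: field_simps)
  qed
  have "((\<lambda>y. mass n y - mass n x) \<longlongrightarrow> 0) (at x)"
  proof (rule Lim_null_comparison)
    show "((\<lambda>y. 2 * K * mass n x / x * \<bar>y - x\<bar>) \<longlongrightarrow> 0) (at x)"
      using assms by (auto intro!: tendsto_eq_intros)
    have "\<forall>\<^sub>F y in at x. y \<in> {x/2<..<2 * x}"
      using assms by (intro eventually_at_in_open') auto
    then show "\<forall>\<^sub>F y in at x. norm (mass n y - mass n x) \<le> 2 * K * mass n x / x * \<bar>y - x\<bar>"
    proof eventually_elim
      case (elim y)
      then show ?case
        using diff[of x y] diff[of y x] mass_mono[of x y n] mass_mono[of y x n] assms
        by (cases "x \<le> y") auto
    qed
  qed
  then show ?thesis unfolding isCont_def by (rule LIM_zero_cancel)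
qed

lemma mass_surj:
  assumes "0 \<le> r" obtains t where "0 \<le> t" "mass n t = r"
proof (cases "r = 0")
  case True
  show ?thesis by (rule that[of 0]) (use True in auto)
next
  case False
  define c where "c = mass n 1"
  have c: "0 < c" unfolding c_def by (rule mass_pos) simp
  \<comment> \<open>Comparison with \<open>mass n 1\<close> grows like a square root, which suggests
    \<open>(r/c)\<^sup>2\<close>. Cutting it off at 1 from either side yields points whose masses
    bracket \<open>r\<close>.\<close>
  define a b where "a = max 1 ((r/c)\<^sup>2)" and "b = min 1 ((r/c)\<^sup>2)"
  have b: "0 < b" "b \<le> 1" and a: "1 \<le> a" using False c by (auto simp: a_def b_def)
  have "r = sqrt ((r/c)\<^sup>2) * c" using assms c by simp
  also have "\<dots> \<le> sqrt a * c" using c by (intro mult_right_mono real_sqrt_le_mono) (auto simp: a_def)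
  also have "\<dots> \<le> mass n a" using mass_scale_ge[of 1 a n] a by (simp add: c_def)
  finally have ra: "r \<le> mass n a" .
  have "sqrt (1/b) * mass n b \<le> c" using mass_scale_ge[of b 1 n] b by (simp add: c_def)
  then have "mass n b \<le> sqrt b * c" using b by (simp add: real_sqrt_divide field_simps)
  also have "\<dots> \<le> sqrt ((r/c)\<^sup>2) * c" using c by (intro mult_right_mono real_sqrt_le_mono) (auto simp: b_def)
  also have "\<dots> = r" using assms c by simp
  finally have rb: "mass n b \<le> r" .
  have "continuous_on {b..a} (mass n)"
    using b by (intro continuous_at_imp_continuous_on ballI isCont_mass) auto
  with IVT'[of "mass n" b r a] ra rb a b obtain t where "b \<le> t" "mass n t = r" by auto
  then show ?thesis using b that[of t] by auto
qed

section \<open>The function \<open>h_psi\<close> as inverse of the mass\<close>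

lemma h_psi_eq:
  fixes n :: "'n::finite itself"
  assumes "0 \<le> t" shows "h_psi n \<psi> (mass n t) = t"
proof -
  have iff: "has_bochner_integral lebesgue
      (\<lambda>v :: real ^ 'n. psi_inv \<psi> (max (s - 1/2 * (norm v)\<^sup>2) 0)) r \<longleftrightarrow> mass n s = r" for s r
    using gp_profile_integrable[where u = "0 :: real ^ 'n" and t = s]
    by (simp add: has_bochner_integral_iff mass_def gp_def)
  show ?thesis unfolding h_psi_def iff
  \<comment> \<open>Strict monotonicity of \<open>mass\<close> supplies the uniqueness behind the
    definite description.\<close>
  proof (rule the_equality)
    fix s assume "0 \<le> s \<and> mass n s = mass n t"
    then show "s = t" using mass_strict_mono[of s t n] mass_strict_mono[of t s n] assms by force
  qed (use assms in auto)
qed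

lemma h_psi_nonneg: "0 \<le> r \<Longrightarrow> 0 \<le> h_psi n \<psi> r"
  and mass_h_psi: "0 \<le> r \<Longrightarrow> mass n (h_psi n \<psi> r) = r"
  by (metis h_psi_eq mass_surj)+

lemma h_psi_le_iff: "0 \<le> r \<Longrightarrow> 0 \<le> t \<Longrightarrow> t \<le> h_psi n \<psi> r \<longleftrightarrow> mass n t \<le> r"
  by (metis h_psi_nonneg mass_h_psi mass_mono mass_strict_mono not_le)

lemma h_psi_integrable:
  assumes "0 \<le> a" shows "h_psi n \<psi> integrable_on {a..r}"
  by (rule integrable_on_mono_on)
    (use assms in \<open>auto simp: mono_on_def h_psi_le_iff h_psi_nonneg mass_h_psi\<close>)

text \<open>By \<open>mass_half\<close>, \<open>h_psi\<close> is at least half its final value on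
  the last quarter of \<open>[0, r]\<close>; the factor 8 is 2 times 4.\<close>

lemma Phi_psi_ge:
  fixes n :: "'n::finite itself"
  assumes "0 \<le> r" shows "h_psi n \<psi> r * r \<le> 8 * Phi_psi n \<psi> r"
proof -
  let ?h = "h_psi n \<psi>"
  have "?h r / 2 \<le> ?h s" if "s \<in> {3/4 * r..r}" for s
    using mass_half[of "?h r" n] that assms
    by (subst h_psi_le_iff) (auto simp: h_psi_nonneg mass_h_psi)
  then have "integral {3/4 * r..r} (\<lambda>_. ?h r / 2) \<le> integral {3/4 * r..r} ?h"
    using assms by (intro integral_le h_psi_integrable) auto
  also have "\<dots> \<le> integral {0..r} ?h"
    using assms by (intro integral_subset_le h_psi_integrable) (auto simp: h_psi_nonneg)
  finally show ?thesis using assms by (simp add: Phi_psi_def mult.commute)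
qed

section \<open>Stability of the free energy\<close>

lemma maxwellian_eq:
  fixes f :: "real ^ 'n::finite \<Rightarrow> real"
  shows "maxwellian \<psi> f v =
    gp (h_psi TYPE('n) \<psi> (rho f) - 1/2 * (norm (v - bulk_velocity f))\<^sup>2)"
  by (simp add: maxwellian_def gp_def)

lemma
  assumes "f \<in> admissible \<psi>"
  shows admissible_integrable: "integrable lebesgue f"
    and admissible_AE_nonneg: "AE v in lebesgue. 0 \<le> f v"
    and admissible_moment_integrable: "integrable lebesgue (\<lambda>v. (norm v)\<^sup>2 * f v)"
    and admissible_Psi_integrable: "integrable lebesgue (\<lambda>v. Psi \<psi> (f v))"
proof -
  show f: "integrable lebesgue f" and nn: "AE v in lebesgue. 0 \<le> f v"
    using assms by (auto simp: admissible_def)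
  have e: "integrable lebesgue (\<lambda>v. (norm v)\<^sup>2 * f v + Psi \<psi> (f v))"
    using assms by (auto simp: admissible_def)
  have [measurable]: "f \<in> borel_measurable lebesgue" using f by auto
  show "integrable lebesgue (\<lambda>v. Psi \<psi> (f v))"
    by (rule Bochner_Integration.integrable_bound[OF e]) (use nn in \<open>auto simp: Psi_nonneg\<close>)
  from Bochner_Integration.integrable_diff[OF e this]
  show "integrable lebesgue (\<lambda>v. (norm v)\<^sup>2 * f v)" by simp
qed

lemma rho_nonneg: "f \<in> admissible \<psi> \<Longrightarrow> 0 \<le> rho f"
  unfolding rho_def by (intro integral_nonneg_AE admissible_AE_nonneg)

text \<open>For zero mass the default velocity 0 is consistent, since \<open>f\<close> then vanishes
  almost everywhere.\<close>

lemma admissible_momentum: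
  fixes f :: "real ^ 'n::finite \<Rightarrow> real"
  assumes "f \<in> admissible \<psi>"
  shows "(LINT v|lebesgue. f v *\<^sub>R v) = rho f *\<^sub>R bulk_velocity f"
proof (cases "rho f > 0")
  case False
  then have "(LINT v|lebesgue. f v) = 0" using rho_nonneg[OF assms] by (simp add: rho_def)
  then have "AE v in lebesgue. f v = 0"
    using integral_nonneg_eq_0_iff_AE[OF admissible_integrable[OF assms] admissible_AE_nonneg[OF assms]]
    by simp
  then have "(LINT v|lebesgue. f v *\<^sub>R v) = 0" by (intro integral_eq_zero_AE) auto
  then show ?thesis using False rho_nonneg[OF assms] by simp
qed (simp add: bulk_velocity_def)

text \<open>The integrand is odd under the reflection of \<open>v\<close> through
  \<open>u\<close>.\<close>

lemma gp_profile_momentum: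
  fixes u :: "'a::euclidean_space"
  shows "(LINT v|lebesgue. (u \<bullet> (v - u)) * gp (t - 1/2 * (norm (v - u))\<^sup>2)) = 0"
    (is "integral\<^sup>L lebesgue ?F = 0")
proof -
  have "integral\<^sup>L lebesgue ?F = (LINT v|lebesgue. ?F (2 *\<^sub>R u - v))"
    by (subst integral_lebesgue_affine[where t = "2 *\<^sub>R u" and c = "-1"]) auto
  also have "\<dots> = (LINT v|lebesgue. - ?F v)"
  proof (rule Bochner_Integration.integral_cong)
    fix v
    have *: "2 *\<^sub>R u - v - u = - (v - u)" by (simp add: scaleR_2)
    show "?F (2 *\<^sub>R u - v) = - ?F v" unfolding * by (simp only: inner_minus_right norm_minus_cancel mult_minus_left)
  qed simp
  finally show ?thesis by simp
qed

end

section \<open>The relative free energy of a fixed admissible density\<close>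

locale admissible_density = doubling_psi \<psi> \<Lambda> for \<psi> :: "real \<Rightarrow> real" and \<Lambda> :: real +
  fixes f :: "real ^ 'n::finite \<Rightarrow> real"
  assumes adm: "f \<in> admissible \<psi>"
begin

abbreviation "u \<equiv> bulk_velocity f"
abbreviation "M \<equiv> maxwellian \<psi> f"

definition h :: real
  where "h = h_psi TYPE('n) \<psi> (rho f)"

definition E :: "real ^ 'n \<Rightarrow> real"
  where "E v = bregman (h - 1/2 * (norm (v - u))\<^sup>2) (f v)"

lemma M_eq: "M v = gp (h - 1/2 * (norm (v - u))\<^sup>2)"
  by (simp add: maxwellian_eq h_def)

lemma h_nonneg: "0 \<le> h"
  by (simp add: h_def h_psi_nonneg rho_nonneg[OF adm])

lemma mass_h: "mass TYPE('n) h = rho f"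
  by (simp add: h_def mass_h_psi rho_nonneg[OF adm])

lemmas f_integrable [simp] = admissible_integrable[OF adm]
  and f_AE_nonneg = admissible_AE_nonneg[OF adm]
  and f_moment_integrable [simp] = admissible_moment_integrable[OF adm]
  and Psi_f_integrable [simp] = admissible_Psi_integrable[OF adm]

lemma M_integrable [simp]: "integrable lebesgue M"
  and M_moment_integrable [simp]: "integrable lebesgue (\<lambda>v. (norm v)\<^sup>2 * M v)"
  and Psi_M_integrable [simp]: "integrable lebesgue (\<lambda>v. Psi \<psi> (M v))"
  unfolding M_eq
  by (rule gp_profile_integrable gp_profile_moment_integrable Psi_gp_profile_integrable)+

lemma inner_integrable:
  assumes "integrable lebesgue F" "integrable lebesgue (\<lambda>v. (norm v)\<^sup>2 * F v)"
  shows "integrable lebesgue (\<lambda>v. (u \<bullet> (v - u)) * F v)"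
proof -
  have "integrable lebesgue (\<lambda>v. u \<bullet> (F v *\<^sub>R v) - (u \<bullet> u) * F v)"
    by (intro Bochner_Integration.integrable_diff integrable_inner_right integrable_first_moment
        integrable_mult_right assms)
  then show ?thesis by (simp add: inner_diff_right algebra_simps)
qed

text \<open>The correction terms use \<open>v - u\<close> rather than \<open>v\<close>, so that each
  of the last three integrates to 0: the first by equal mass, the others because the momentum
  relative to \<open>u\<close> vanishes.\<close>

lemma E_eq: "E v = (1/2 * (norm v)\<^sup>2 * f v + Psi \<psi> (f v)) - (1/2 * (norm v)\<^sup>2 * M v + Psi \<psi> (M v))
   - (h + 1/2 * (norm u)\<^sup>2) * (f v - M v) - (u \<bullet> (v - u)) * f v + (u \<bullet> (v - u)) * M v"
proof -
  have *: "1/2 * (norm (v - u))\<^sup>2 = 1/2 * (norm v)\<^sup>2 - u \<bullet> (v - u) - 1/2 * (norm u)\<^sup>2"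
    by (simp add: power2_norm_eq_inner inner_diff_left inner_diff_right inner_commute)
  then show ?thesis
    unfolding E_def bregman_def M_eq[symmetric] unfolding * by (simp only: algebra_simps)
qed

lemma E_integrable [simp]: "integrable lebesgue E"
  and integral_E: "(LINT v|lebesgue. E v) = rel_free_energy \<psi> f"
proof -
  have int: "integrable lebesgue (\<lambda>v. 1/2 * (norm v)\<^sup>2 * f v + Psi \<psi> (f v))"
    "integrable lebesgue (\<lambda>v. 1/2 * (norm v)\<^sup>2 * M v + Psi \<psi> (M v))"
    "integrable lebesgue (\<lambda>v. (h + 1/2 * (norm u)\<^sup>2) * (f v - M v))"
    by (simp_all only: mult.assoc) auto
  note int = int inner_integrable[OF f_integrable f_moment_integrable]
    inner_integrable[OF M_integrable M_moment_integrable]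
  show "integrable lebesgue E"
    unfolding E_eq[abs_def]
    by (rule int | rule Bochner_Integration.integrable_add Bochner_Integration.integrable_diff)+
  have M_mass: "(LINT v|lebesgue. M v) = rho f"
    unfolding M_eq mass_shift by (rule mass_h)
  have f_mom: "(LINT v|lebesgue. (u \<bullet> (v - u)) * f v) = 0"
  proof -
    have "(LINT v|lebesgue. (u \<bullet> (v - u)) * f v) = (LINT v|lebesgue. u \<bullet> (f v *\<^sub>R v) - (u \<bullet> u) * f v)"
      by (simp add: inner_diff_right algebra_simps)
    also have "\<dots> = u \<bullet> (LINT v|lebesgue. f v *\<^sub>R v) - (u \<bullet> u) * rho f"
      by (simp add: integrable_first_moment rho_def del: inner_scaleR_right)
    finally show ?thesis by (simp add: admissible_momentum[OF adm])
  qed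
  have M_mom: "(LINT v|lebesgue. (u \<bullet> (v - u)) * M v) = 0"
    unfolding M_eq by (rule gp_profile_momentum)
  have "(LINT v|lebesgue. (h + 1/2 * (norm u)\<^sup>2) * (f v - M v)) = 0"
    by (simp add: M_mass) (simp add: rho_def)
  with int f_mom M_mom show "(LINT v|lebesgue. E v) = rel_free_energy \<psi> f"
    unfolding E_eq[abs_def] rel_free_energy_def free_energy_def by simp
qed

lemma E_AE_nonneg: "AE v in lebesgue. 0 \<le> E v"
  using f_AE_nonneg by eventually_elim (simp add: E_def bregman_nonneg)

lemma rel_free_energy_nonneg: "0 \<le> rel_free_energy \<psi> f"
  unfolding integral_E[symmetric] by (rule integral_nonneg_AE) (rule E_AE_nonneg)

lemma Phi_ge: "h * rho f \<le> 8 * Phi_psi TYPE('n) \<psi> (rho f)"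
  unfolding h_def by (rule Phi_psi_ge) (rule rho_nonneg[OF adm])

lemma Phi_nonneg: "0 \<le> Phi_psi TYPE('n) \<psi> (rho f)"
proof -
  have "0 \<le> h * rho f" by (intro mult_nonneg_nonneg h_nonneg rho_nonneg[OF adm])
  with Phi_ge show ?thesis by linarith
qed

lemma L1_distance_le:
  assumes "0 < \<delta>"
  shows "(LINT v|lebesgue. \<bar>f v - M v\<bar>) \<le> 2 / \<delta> * rel_free_energy \<psi> f
    + 2 * (mass TYPE('n) (h + \<delta>) - mass TYPE('n) (h - \<delta>))"
proof -
  let ?G = "\<lambda>t v. gp (t - 1/2 * (norm (v - u))\<^sup>2)"
  have "(LINT v|lebesgue. \<bar>f v - M v\<bar>) \<le>
    (LINT v|lebesgue. 2 / \<delta> * E v + 2 * (?G (h + \<delta>) v - ?G (h - \<delta>) v))"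
  proof (rule integral_mono_AE)
    show "AE v in lebesgue. \<bar>f v - M v\<bar> \<le> 2 / \<delta> * E v + 2 * (?G (h + \<delta>) v - ?G (h - \<delta>) v)"
      using f_AE_nonneg
    proof eventually_elim
      case (elim v)
      from diff_le_bregman[OF this assms, of "h - 1/2 * (norm (v - u))\<^sup>2"]
      show ?case unfolding M_eq E_def by (simp add: algebra_simps)
    qed
  qed (intro Bochner_Integration.integrable_add Bochner_Integration.integrable_diff
      integrable_mult_right integrable_abs gp_profile_integrable E_integrable f_integrable M_integrable)+
  also have "\<dots> = 2 / \<delta> * (LINT v|lebesgue. E v)
      + 2 * (mass TYPE('n) (h + \<delta>) - mass TYPE('n) (h - \<delta>))"
    by (simp add: gp_profile_integrable[simplified] mass_shift[simplified])
  finally show ?thesis by (simp add: integral_E)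
qed

lemma weighted_L1_distance_le:
  assumes "0 < \<epsilon>" "\<epsilon> \<le> 1"
  shows "h * (LINT v|lebesgue. \<bar>f v - M v\<bar>) \<le> 16 * (2 ^ CARD('n) * (1 + 2 * \<Lambda>\<^sup>2)) *
    (\<epsilon> * Phi_psi TYPE('n) \<psi> (rho f) + rel_free_energy \<psi> f / \<epsilon>)"
proof -
  let ?m = "mass TYPE('n)" and ?R = "rel_free_energy \<psi> f" and ?\<Phi> = "Phi_psi TYPE('n) \<psi> (rho f)"
  define K where "K = 2 ^ CARD('n) * (1 + 2 * \<Lambda>\<^sup>2)"
  have "1 * 1 \<le> K" unfolding K_def by (intro mult_mono) auto
  then have K: "1 \<le> K" by simp
  note nonneg = rel_free_energy_nonneg Phi_nonneg
  have "h * (LINT v|lebesgue. \<bar>f v - M v\<bar>) \<le> 8 / \<epsilon> * ?R + 2 * K * \<epsilon> * (h * rho f)"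
  proof (cases "h = 0")
    case True
    then show ?thesis using nonneg assms by simp
  next
    case False
    then have h: "0 < h" using h_nonneg by simp
    \<comment> \<open>This keeps \<open>h + \<delta> < 2 * (h - \<delta>)\<close>, as
      \<open>mass_increment_le\<close> requires, and makes the relative increment at most
      \<epsilon>.\<close>
    define \<delta> where "\<delta> = \<epsilon> * h / 4"
    have \<delta>: "0 < \<delta>" "\<delta> \<le> h / 4" using h assms by (auto simp: \<delta>_def)
    have "?m (h + \<delta>) - ?m (h - \<delta>) \<le> K * ((h + \<delta>) / (h - \<delta>) - 1) * ?m (h - \<delta>)"
      using mass_increment_le[of "h - \<delta>" "h + \<delta>" "TYPE('n)"] \<delta> h
      by (simp add: K_def algebra_simps)
    also have "(h + \<delta>) / (h - \<delta>) - 1 \<le> \<epsilon>"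
    proof -
      have "\<epsilon> * (3/4 * h) \<le> \<epsilon> * (h - \<delta>)" using \<delta> assms by (intro mult_left_mono) auto
      moreover have "2 * \<delta> \<le> \<epsilon> * (3/4 * h)" using assms h by (simp add: \<delta>_def)
      ultimately have "2 * \<delta> \<le> \<epsilon> * (h - \<delta>)" by linarith
      then show ?thesis using \<delta> h by (simp add: field_simps)
    qed
    also have "K * \<epsilon> * ?m (h - \<delta>) \<le> K * \<epsilon> * rho f"
      unfolding mass_h[symmetric] using K \<delta> assms by (intro mult_left_mono mass_mono) auto
    finally have m: "?m (h + \<delta>) - ?m (h - \<delta>) \<le> K * \<epsilon> * rho f"
      using K by (simp add: mult_left_mono mult_right_mono mass_nonneg)
    have "h * (LINT v|lebesgue. \<bar>f v - M v\<bar>) \<le> h * (2 / \<delta> * ?R + 2 * (K * \<epsilon> * rho f))"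
      using L1_distance_le[OF \<delta>(1)] m h by (intro mult_left_mono) auto
    also have "\<dots> = 8 / \<epsilon> * ?R + 2 * K * \<epsilon> * (h * rho f)"
      using h assms by (simp add: \<delta>_def field_simps)
    finally show ?thesis .
  qed
  also have "2 * K * \<epsilon> * (h * rho f) \<le> 2 * K * \<epsilon> * (8 * ?\<Phi>)"
    using K assms Phi_ge by (intro mult_left_mono) auto
  also have "8 / \<epsilon> * ?R \<le> 16 * K * (?R / \<epsilon>)"
  proof -
    have "8 * (?R / \<epsilon>) \<le> 16 * K * (?R / \<epsilon>)" using K nonneg assms by (intro mult_right_mono) auto
    then show ?thesis by simp
  qed
  finally show ?thesis unfolding K_def[symmetric] by (simp add: algebra_simps)
qed

lemma stability:
  "(LINT v|lebesgue. 1/2 * (norm (v - u))\<^sup>2 * \<bar>f v - M v\<bar> + \<bar>Psi \<psi> (f v) - Psi \<psi> (M v)\<bar>)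
    \<le> (32 * (2 ^ CARD('n) * (1 + 2 * \<Lambda>\<^sup>2)) + 1) *
      (sqrt (Phi_psi TYPE('n) \<psi> (rho f)) * sqrt (rel_free_energy \<psi> f) + rel_free_energy \<psi> f)"
  (is "?L \<le> (32 * ?K + 1) * (?S + ?R)")
proof -
  let ?X = "h * (LINT v|lebesgue. \<bar>f v - M v\<bar>)"
  have "?L \<le> (LINT v|lebesgue. h * \<bar>f v - M v\<bar> + E v)"
  \<comment> \<open>The comparison asks for an integrable majorant that is nonnegative almost
    everywhere.\<close>
  proof (rule integral_mono_AE')
    show "AE v in lebesgue. 1/2 * (norm (v - u))\<^sup>2 * \<bar>f v - M v\<bar> + \<bar>Psi \<psi> (f v) - Psi \<psi> (M v)\<bar>
        \<le> h * \<bar>f v - M v\<bar> + E v"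
      using f_AE_nonneg
    proof eventually_elim
      case (elim v)
      show ?case unfolding M_eq E_def by (rule energy_density_le) (use elim h_nonneg in auto)
    qed
    show "AE v in lebesgue. 0 \<le> h * \<bar>f v - M v\<bar> + E v"
      using E_AE_nonneg by eventually_elim (simp add: h_nonneg)
  qed auto
  also have "\<dots> = ?X + ?R" by (simp add: integral_E)
  finally have "?L \<le> ?X + ?R" .
  moreover have "?X \<le> 2 * (16 * ?K) * (?S + ?R)"
    by (rule sqrt_interpolation)
      (auto intro: weighted_L1_distance_le rel_free_energy_nonneg Phi_nonneg)
  \<comment> \<open>This separate contribution of \<open>E\<close> is the \<open>+ 1\<close> in the
    constant.\<close>
  moreover have "?R \<le> ?S + ?R" using rel_free_energy_nonneg Phi_nonneg by simp
  ultimately have "?L \<le> 2 * (16 * ?K) * (?S + ?R) + (?S + ?R)" by linarith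
  also have "\<dots> = (32 * ?K + 1) * (?S + ?R)" by (simp only: distrib_right) simp
  finally show ?thesis .
qed

end

text \<open>The constant of \<open>stability\<close> involves only \<Lambda> and the dimension, so
  it can be fixed before \<psi> and \<open>f\<close>.\<close>

theorem proposition5p1:
  fixes \<Lambda> :: real
  assumes "\<Lambda> \<ge> 1"
  shows "\<exists>C>0. \<forall>(\<psi> :: real \<Rightarrow> real) (f :: real ^ 'n::finite \<Rightarrow> real).
    psi_basic \<psi> \<longrightarrow> A1 \<psi> \<longrightarrow> A2 \<psi> \<longrightarrow> A3 \<Lambda> \<psi> \<longrightarrow> f \<in> admissible \<psi> \<longrightarrow>
      (LINT v|lebesgue.
          1/2 * (norm (v - bulk_velocity f))\<^sup>2 * \<bar>f v - maxwellian \<psi> f v\<bar>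
          + \<bar>Psi \<psi> (f v) - Psi \<psi> (maxwellian \<psi> f v)\<bar>)
      \<le> C * (sqrt (Phi_psi TYPE('n) \<psi> (rho f)) * sqrt (rel_free_energy \<psi> f)
             + rel_free_energy \<psi> f)"
proof (intro exI[of _ "32 * (2 ^ CARD('n) * (1 + 2 * \<Lambda>\<^sup>2)) + 1"] conjI allI impI)
  show "0 < 32 * (2 ^ CARD('n) * (1 + 2 * \<Lambda>\<^sup>2)) + 1" by (simp add: add_nonneg_pos)
next
  fix \<psi> :: "real \<Rightarrow> real" and f :: "real ^ 'n \<Rightarrow> real"
  assume "psi_basic \<psi>" "A1 \<psi>" "A2 \<psi>" "A3 \<Lambda> \<psi>" "f \<in> admissible \<psi>"
  then interpret admissible_density \<psi> \<Lambda> f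
    using assms by unfold_locales
  show "(LINT v|lebesgue. 1/2 * (norm (v - bulk_velocity f))\<^sup>2 * \<bar>f v - maxwellian \<psi> f v\<bar>
          + \<bar>Psi \<psi> (f v) - Psi \<psi> (maxwellian \<psi> f v)\<bar>)
      \<le> (32 * (2 ^ CARD('n) * (1 + 2 * \<Lambda>\<^sup>2)) + 1) *
        (sqrt (Phi_psi TYPE('n) \<psi> (rho f)) * sqrt (rel_free_energy \<psi> f) + rel_free_energy \<psi> f)"
    by (rule stability)
qed

end
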